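(* Consider the linear extended bifactor model and let $(A,\mathbf d,\Sigma_G,\boldsymbol\lambda)\in\mathfrak P$. If the model is identifiable at $(A,\mathbf d,\Sigma_G,\boldsymbol\lambda)$, then both of the following conditions hold: (E1N) $|\mathcal Q_g|\ge 2$ for all $g=1,\dots,G$, and $|\mathcal Q_g|\ge 3$ for every $g$ such that $\Sigma_G[g,-g]=\mathbf 0$; (E2N) $|\mathcal H_3|\ge 2$.
   Context: Linear extended bifactor model. Fix $G\ge 1$ and items $\{1,\dots,J\}$ with a fixed known partition into $G$ nonempty testlets $\mathcal B_1,\dots,\mathcal B_G$; $g_j$ is the testlet containing item $j$. Parameters: a real $J\times(1+G)$ loading matrix $A=[\mathbf a_0,\mathbf a_1,\dots,\mathbf a_G]$ with $\mathbf a_g[j]=0$ whenever $g\ge1$ and $g\ne g_j$ (the other entries are arbitrary reals, possibly zero); intercepts $\mathbf d\in\mathbb R^J$; a $G\times G$ symmetric positive definite matrix $\Sigma_G$ with all diagonal entries equal to 1; unique variances $\boldsymbol\lambda=(\lambda_1,\dots,\lambda_J)$ with $\lambda_j>0$. The observed vector $(Y_1,\dots,Y_J)$ is $$Y_j=d_j+\mathbf a_0[j]\,\eta_0+\mathbf a_{g_j}[j]\,\eta_{g_j}+\epsilon_j,$$ where $\boldsymbol\eta=(\eta_0,\eta_1,\dots,\eta_G)^T\sim N(\mathbf 0,\Sigma)$ with $\Sigma=\begin{pmatrix}1&\mathbf 0^T\\ \mathbf 0&\Sigma_G\end{pmatrix}$, and the $\epsilon_j\sim N(0,\lambda_j)$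 are independent of each other and of $\boldsymbol\eta$. The parameter space $\mathfrak P$ is the set of all such $(A,\mathbf d,\Sigma_G,\boldsymbol\lambda)$ for which the first nonzero entry of every column of $A$ is positive (no requirement on a zero column). The model is identifiable at $(A,\mathbf d,\Sigma_G,\boldsymbol\lambda)\in\mathfrak P$ if every $(A',\mathbf d',\Sigma_G',\boldsymbol\lambda')\in\mathfrak P$ that defines the same distribution of $(Y_1,\dots,Y_J)$ equals $(A,\mathbf d,\Sigma_G,\boldsymbol\lambda)$. Notation: $x[\mathcal B]$ is the subvector of $x$ with entries in $\mathcal B$; $\bar A_g=(\mathbf a_0[\mathcal B_g],\mathbf a_g[\mathcal B_g])$ is the $|\mathcal B_g|\times 2$ matrix of main and testlet loadings of testlet $g$; $\Sigma_G[g,-g]$ is the $g$-th row of $\Sigma_G$ with its $g$-th entry removed. - $\mathcal Q_g=\{j:\mathbf a_g[j]\ne 0\}$ for $g=1,\dots,G$. - $\mathcal H_3=\{g\in\{1,\dots,G\}:\bar A_g\text{ has column rank }2\}$. *)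

theory Defs
  imports "HOL-Probability.Probability"
begin

text \<open>
  Items are the elements of a finite ordered type \<open>'j\<close>, testlets those of a finite type \<open>'g\<close>.
  The partition of the items into testlets is a map \<open>t :: 'j \<Rightarrow> 'g\<close> sending an item to its testlet;
  all testlets are nonempty iff \<open>t\<close> is surjective.  The factors (and the columns of the loading
  matrix) are indexed by \<open>'g option\<close>: \<open>None\<close> is the main factor, \<open>Some g\<close> the factor of testlet \<open>g\<close>.
\<close>

definition sym_pos_def :: "real^'n^'n \<Rightarrow> bool" where
  "sym_pos_def S \<longleftrightarrow> transpose S = S \<and> (\<forall>x. x \<noteq> 0 \<longrightarrow> x \<bullet> (S *v x) > 0)"

definition mvnormal_density :: "real^'n \<Rightarrow> real^'n^'n \<Rightarrow> real^'n \<Rightarrow> real" where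
  "mvnormal_density \<mu> S x =
     1 / sqrt ((2 * pi) ^ CARD('n) * det S) *
     exp (- ((x - \<mu>) \<bullet> (matrix_inv S *v (x - \<mu>))) / 2)"

text \<open>The law \<open>N(\<mu>, S)\<close>; only meaningful for symmetric positive definite \<open>S\<close>.\<close>

definition mvnormal :: "real^'n \<Rightarrow> real^'n^'n \<Rightarrow> (real^'n) measure" where
  "mvnormal \<mu> S = density lborel (\<lambda>x. ennreal (mvnormal_density \<mu> S x))"

definition factor_cov :: "real^'g^'g \<Rightarrow> real^('g option)^('g option)" where
  "factor_cov S = (\<chi> a b. case (a, b) of
       (None, None) \<Rightarrow> 1
     | (Some g, Some h) \<Rightarrow> S $ g $ h
     | _ \<Rightarrow> 0)"

definition observed ::
  "('j::finite \<Rightarrow> 'g::finite) \<Rightarrow> real^('g option)^'j \<Rightarrow> real^'j \<Rightarrow> (real^('g option)) \<times> ('j \<Rightarrow> real) \<Rightarrow> real^'j" where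
  "observed t A d = (\<lambda>(\<eta>, \<epsilon>). \<chi> j.
     d $ j + A $ j $ None * \<eta> $ None + A $ j $ Some (t j) * \<eta> $ Some (t j) + \<epsilon> j)"

text \<open>
  The distribution of the observed vector.  The product measure is the joint law of the factors
  and the unique errors, i.e. it encodes all independence assumptions.  The parameter of
  \<^const>\<open>normal_density\<close> is the standard deviation.
\<close>

definition bifactor_law ::
  "('j::finite \<Rightarrow> 'g::finite) \<Rightarrow> real^('g option)^'j \<Rightarrow> real^'j \<Rightarrow> real^'g^'g \<Rightarrow> real^'j \<Rightarrow> (real^'j) measure" where
  "bifactor_law t A d S l =
     distr (mvnormal 0 (factor_cov S) \<Otimes>\<^sub>M
            (\<Pi>\<^sub>M j\<in>UNIV. density lborel (\<lambda>x. ennreal (normal_density 0 (sqrt (l $ j)) x))))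
       borel (observed t A d)"

definition param_space ::
  "('j::{finite,linorder} \<Rightarrow> 'g::finite) \<Rightarrow>
   real^('g option)^'j::_ \<Rightarrow> real^'j::_ \<Rightarrow> real^'g^'g \<Rightarrow> real^'j::_ \<Rightarrow> bool" where
  "param_space t A d S l \<longleftrightarrow>
     (\<forall>j g. g \<noteq> t j \<longrightarrow> A $ j $ Some g = 0) \<and>
     (\<forall>c j. A $ j $ c \<noteq> 0 \<and> (\<forall>i<j. A $ i $ c = 0) \<longrightarrow> A $ j $ c > 0) \<and>
     sym_pos_def S \<and> (\<forall>g. S $ g $ g = 1) \<and>
     (\<forall>j. l $ j > 0)"

definition identifiable_at ::
  "('j::{finite,linorder} \<Rightarrow> 'g::finite) \<Rightarrow>
   real^('g option)^'j::_ \<Rightarrow> real^'j::_ \<Rightarrow> real^'g^'g \<Rightarrow> real^'j::_ \<Rightarrow> bool" where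
  "identifiable_at t A d S l \<longleftrightarrow>
     (\<forall>A' d' S' l'. param_space t A' d' S' l' \<and>
        bifactor_law t A' d' S' l' = bifactor_law t A d S l \<longrightarrow>
        A' = A \<and> d' = d \<and> S' = S \<and> l' = l)"

definition Q_set :: "real^('g::finite option)^'j \<Rightarrow> 'g \<Rightarrow> 'j set" where
  "Q_set A g = {j. A $ j $ Some g \<noteq> 0}"

text \<open>
  The two-column matrix of main and testlet loadings of testlet \<open>g\<close>, with the rows of the items
  outside the testlet replaced by zero rows instead of being removed; this does not change the rank.
\<close>

definition testlet_loadings ::
  "('j::finite \<Rightarrow> 'g::finite) \<Rightarrow> real^('g option)^'j \<Rightarrow> 'g \<Rightarrow> real^2^'j" where
  "testlet_loadings t A g =
     (\<chi> j. if t j = g then vector [A $ j $ None, A $ j $ Some g] else 0)"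

definition H3_set :: "('j::finite \<Rightarrow> 'g::finite) \<Rightarrow> real^('g option)^'j \<Rightarrow> 'g set" where
  "H3_set t A = {g. rank (testlet_loadings t A g) = 2}"

end

theory Submission
  imports Defs "HOL-Library.Option_ord"
begin

text \<open>
  The distribution of the observed vector is Gaussian, so it depends on the loadings, the factor
  correlations and the unique variances only through the covariances
  \<open>V i j = a\<^sub>0 i a\<^sub>0 j + a i a j S (t i) (t j) + \<delta> i j \<lambda> i\<close>, where \<open>a i\<close> is the loading of item \<open>i\<close>
  on its own testlet factor (\<open>bifactor_law_cong\<close>).  Signs of loading columns
  can always be normalised, so at an identifiable parameter every other parameter with the same
  covariances has the same unique variances and, up to signs, the same loading columns
  (\<open>identifiable_up_to_signs\<close>).  Each necessary condition comes from exhibiting such a parameter.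

  For the laws, write the observed vector as \<open>d + M z\<close> with \<open>z\<close> standard Gaussian.  Two
  parameters with equal covariances give matrices \<open>M\<close> whose rows have the same Gram matrix; hence the
  rows correspond under an orthogonal map, and the standard Gaussian is invariant under orthogonal maps.

  The alternative parameters are the following.

  \<^item> If \<open>Q g\<close> is empty, the factor of testlet \<open>g\<close> is irrelevant: make it uncorrelated with the other
    factors and turn half of the unique variance of one item into a loading on it.

  \<^item> If \<open>Q g\<close> is a singleton, scale that loading by \<open>c > 1\<close>, divide the correlations of the factor
    by \<open>c\<close>, and decrease the unique variance.

  \<^item> If \<open>Q g\<close> is a pair and factor \<open>g\<close> is uncorrelated with the others, only the product of the two
    loadings matters off the diagonal: scale one by \<open>c\<close> and the other by \<open>1 / c\<close>.

  \<^item> If all testlets outside \<open>k\<close> have rank at most one, then (the testlet loadings being nonzero) they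
    see the factors only through \<open>\<xi> g = c g \<eta>\<^sub>0 + \<eta> g\<close>.  Exchange the roles of \<open>\<eta>\<^sub>0\<close> and \<open>\<eta> k\<close>: regress every
    \<open>\<xi> g\<close> on \<open>\<eta> k\<close> instead of \<open>\<eta>\<^sub>0\<close>.  Identifiability forces the main and testlet loadings in \<open>k\<close> to
    agree up to sign, so testlet \<open>k\<close> has rank at most one as well.

  \<^item> If no testlet has rank two, the main factor can be dropped altogether by using the
    normalised \<open>\<xi> g\<close> as testlet factors.  Identifiability then forces \<open>a\<^sub>0 = 0\<close>, so by the previous
    item the testlet loadings in \<open>k\<close> vanish, contradicting the first one.

  All new correlation matrices are positive definite because they are covariance matrices of linearly
  independent combinations of the factors and, in the first two cases, of one further independent
  variable.
\<close>

section \<open>Lebesgue measure under linear maps\<close>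

text \<open>
  Uniqueness of Haar measure on a Euclidean space, in a form free of division.  Both sides are
  integrals over the product of the two measures: in the indicator of \<open>A \<times> B\<close>, replace \<open>y\<close> by \<open>x + y\<close> and
  then \<open>x\<close> by \<open>x - y\<close>, using the translation invariance of one measure each time.  What remains is the
  indicator of \<open>B\<close> at \<open>x\<close> times that of a reflected translate of \<open>A\<close> at \<open>y\<close>.
\<close>

lemma translation_invariant_measure_proportional:
  fixes M :: "'a::euclidean_space measure"
  assumes sets_M: "sets M = sets borel"
    and sf: "sigma_finite_measure M"
    and inv: "\<And>c. distr M borel ((+) c) = M"
    and [measurable]: "A \<in> sets borel" "B \<in> sets borel"
  shows "emeasure M A * emeasure lborel B = emeasure M B * emeasure lborel A"
proof -
  interpret M: sigma_finite_measure M by fact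
  interpret pair_sigma_finite M "lborel :: 'a measure"
    by unfold_locales
  note sets_M [measurable_cong]
  let ?I = "\<lambda>X x. indicator X x :: ennreal"
  have shift_M: "(\<integral>\<^sup>+x. f (c + x) \<partial>M) = (\<integral>\<^sup>+x. f x \<partial>M)" if [measurable]: "f \<in> borel_measurable borel" for f c
  proof -
    have "(\<integral>\<^sup>+x. f x \<partial>M) = (\<integral>\<^sup>+x. f x \<partial>distr M borel ((+) c))" by (simp add: inv)
    also have "\<dots> = (\<integral>\<^sup>+x. f (c + x) \<partial>M)" by (subst nn_integral_distr) auto
    finally show ?thesis by simp
  qed
  have shift_L: "(\<integral>\<^sup>+x. f (c + x) \<partial>lborel) = (\<integral>\<^sup>+x. f x \<partial>lborel)" if [measurable]: "f \<in> borel_measurable borel"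
    for f and c :: 'a
  proof -
    have "(\<integral>\<^sup>+x. f x \<partial>lborel) = (\<integral>\<^sup>+x. f x \<partial>distr lborel borel ((+) c))" by (simp add: lborel_distr_plus)
    also have "\<dots> = (\<integral>\<^sup>+x. f (c + x) \<partial>lborel)" by (subst nn_integral_distr) auto
    finally show ?thesis by simp
  qed
  have reflect_L: "(\<integral>\<^sup>+x. f (c - x) \<partial>lborel) = (\<integral>\<^sup>+x. f x \<partial>lborel)" if [measurable]: "f \<in> borel_measurable borel"
    for f and c :: 'a
  proof -
    have "lborel = distr lborel borel (\<lambda>x::'a. c - x)"
      using lborel_affine[of "-1" c] by (simp add: density_1)
    then have "(\<integral>\<^sup>+x. f x \<partial>lborel) = (\<integral>\<^sup>+x. f x \<partial>distr lborel borel (\<lambda>x::'a. c - x))" by simp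
    also have "\<dots> = (\<integral>\<^sup>+x. f (c - x) \<partial>lborel)" by (subst nn_integral_distr) auto
    finally show ?thesis by simp
  qed
  have "emeasure M A * emeasure lborel B = (\<integral>\<^sup>+x. ?I A x * emeasure lborel B \<partial>M)"
    by (subst nn_integral_multc) (auto simp: sets_M)
  also have "\<dots> = (\<integral>\<^sup>+x. (\<integral>\<^sup>+y. ?I A x * ?I B (x + y) \<partial>lborel) \<partial>M)"
    by (intro nn_integral_cong, subst nn_integral_cmult) (auto simp: shift_L[of "indicator B"])
  also have "\<dots> = (\<integral>\<^sup>+y. (\<integral>\<^sup>+x. ?I A x * ?I B (x + y) \<partial>M) \<partial>lborel)"
    by (rule Fubini'[symmetric]) measurable
  also have "\<dots> = (\<integral>\<^sup>+y. (\<integral>\<^sup>+x. ?I A (x - y) * ?I B x \<partial>M) \<partial>lborel)"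
  proof (rule nn_integral_cong)
    fix y
    show "(\<integral>\<^sup>+x. ?I A x * ?I B (x + y) \<partial>M) = (\<integral>\<^sup>+x. ?I A (x - y) * ?I B x \<partial>M)"
      using shift_M[of "\<lambda>x. ?I A (x - y) * ?I B x" y] by (simp add: add.commute)
  qed
  also have "\<dots> = (\<integral>\<^sup>+x. (\<integral>\<^sup>+y. ?I A (x - y) * ?I B x \<partial>lborel) \<partial>M)"
    by (rule Fubini') measurable
  also have "\<dots> = (\<integral>\<^sup>+x. emeasure lborel A * ?I B x \<partial>M)"
    by (intro nn_integral_cong, subst nn_integral_multc) (auto simp: reflect_L[of "indicator A"])
  also have "\<dots> = emeasure M B * emeasure lborel A"
    by (subst nn_integral_cmult) (auto simp: sets_M mult.commute)
  finally show ?thesis .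
qed

text \<open>
  The image of Lebesgue measure under a linear bijection is translation invariant, hence a multiple
  of Lebesgue measure; the factor can be read off from any one set, here the unit ball.
\<close>

lemma distr_lborel_linear_bij:
  fixes f g :: "'a::euclidean_space \<Rightarrow> 'a"
  assumes f: "linear f" and g: "linear g" and fg: "\<And>x. f (g x) = x" and gf: "\<And>x. g (f x) = x"
    and c: "emeasure lborel (g ` ball 0 1) = c * emeasure lborel (ball 0 1 :: 'a set)"
  shows "distr lborel borel f = density lborel (\<lambda>_. c)"
proof -
  have [measurable]: "f \<in> borel_measurable borel" "g \<in> borel_measurable borel"
    using f g by (auto intro!: borel_measurable_continuous_onI linear_continuous_on simp: linear_conv_bounded_linear)
  let ?M = "distr lborel borel f"
  have vim: "f -` A = g ` A" for A
    using fg gf by (auto simp: image_iff) metis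
  have sf: "sigma_finite_measure ?M"
  proof
    show "\<exists>A. countable A \<and> A \<subseteq> sets ?M \<and> \<Union>A = space ?M \<and> (\<forall>a\<in>A. emeasure ?M a \<noteq> \<infinity>)"
    proof (intro exI conjI ballI)
      let ?A = "range (\<lambda>n::nat. ball (0::'a) (real n))"
      show "\<Union>?A = space ?M" by (auto simp: reals_Archimedean2)
      fix a assume "a \<in> ?A"
      then obtain n where a: "a = ball 0 (real n)" by auto
      have "bounded (g ` a)" using g a bounded_linear_image linear_conv_bounded_linear by blast
      then show "emeasure ?M a \<noteq> \<infinity>"
        using emeasure_bounded_finite[of "g ` a"] a by (simp add: emeasure_distr vim)
    qed auto
  qed
  have inv: "distr ?M borel ((+) a) = ?M" for a
  proof -
    have "distr ?M borel ((+) a) = distr lborel borel (\<lambda>x. f (g a + x))"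
      by (subst distr_distr) (auto simp: o_def linear_add[OF f] fg)
    also have "\<dots> = distr (distr lborel borel ((+) (g a))) borel f"
      by (subst distr_distr) (auto simp: o_def)
    finally show ?thesis by (simp add: lborel_distr_plus)
  qed
  show ?thesis
  proof (rule measure_eqI)
    fix A :: "'a set" assume "A \<in> sets ?M"
    then have A [measurable]: "A \<in> sets borel" by simp
    let ?b = "emeasure lborel (ball 0 1 :: 'a set)"
    have "unit_ball_vol (real DIM('a)) > 0" by simp
    then have b: "?b \<noteq> 0" "?b \<noteq> top"
      by (simp_all add: emeasure_ball del: unit_ball_vol_pos)
    have "emeasure ?M A * ?b = emeasure ?M (ball 0 1) * emeasure lborel A"
      by (rule translation_invariant_measure_proportional[OF _ sf inv]) auto
    also have "emeasure ?M (ball 0 1) = c * ?b"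
      by (simp add: emeasure_distr vim c)
    finally have "emeasure ?M A * ?b = c * emeasure lborel A * ?b"
      by (simp add: ac_simps)
    then have "emeasure ?M A = c * emeasure lborel A"
      using b by (metis ennreal_mult_divide_eq)
    then show "emeasure ?M A = emeasure (density lborel (\<lambda>_. c)) A"
      by (simp add: emeasure_density_const)
  qed auto
qed

text \<open>
  An orthogonal map preserves the unit ball, so the factor is 1.
\<close>

lemma distr_lborel_orthogonal:
  fixes f :: "'a::euclidean_space \<Rightarrow> 'a"
  assumes f: "orthogonal_transformation f"
  shows "distr lborel borel f = lborel"
proof -
  have i: "orthogonal_transformation (inv f)" using f by (rule orthogonal_transformation_inv)
  have "bij f" using f by (rule orthogonal_transformation_bij)
  then have "distr lborel borel f = density lborel (\<lambda>_. 1)"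
    using image_orthogonal_transformation_ball[OF i, of 0 1] i f
    by (intro distr_lborel_linear_bij[where g = "inv f"])
       (auto simp: orthogonal_transformation_linear bij_is_surj surj_f_inv_f bij_is_inj linear_0)
  then show ?thesis by (simp add: density_1)
qed

text \<open>
  The volume of the linear image of the ball is available for matrices with well-ordered index
  types; the order on \<open>'g option\<close> makes this applicable to the factor covariance.
\<close>

lemma distr_lborel_matrix:
  fixes L K :: "real^'n::{finite,wellorder}^'n::_"
  assumes LK: "L ** K = mat 1" and KL: "K ** L = mat 1"
  shows "distr lborel borel ((*v) L) = density lborel (\<lambda>_. ennreal \<bar>det K\<bar>)"
proof (rule distr_lborel_linear_bij)
  show "L *v (K *v x) = x" "K *v (L *v x) = x" for x
    by (simp_all add: matrix_vector_mul_assoc LK KL)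
  let ?B = "ball 0 1 :: (real^'n::_) set"
  have "open ((*v) K ` ?B)"
    using LK KL by (intro open_bijective_linear_image_eq[THEN iffD2])
       (auto intro!: bij_betw_byWitness[where f' = "(*v) L"] simp: matrix_vector_mul_assoc matrix_vector_mul_linear)
  moreover have "bounded ((*v) K ` ?B)"
    by (intro bounded_linear_image) (auto simp: matrix_vector_mul_bounded_linear)
  ultimately have im: "(*v) K ` ?B \<in> sets borel" "emeasure lborel ((*v) K ` ?B) = ennreal (measure lborel ((*v) K ` ?B))"
    using emeasure_bounded_finite[of "(*v) K ` ?B"] by (auto intro!: emeasure_eq_ennreal_measure simp: less_top)
  have "measure lebesgue ((*v) K ` ?B) = \<bar>det K\<bar> * measure lebesgue ?B"
    using measure_linear_image[of "(*v) K" ?B] by (simp add: matrix_vector_mul_linear)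
  moreover have "emeasure lborel ?B = ennreal (measure lborel ?B)"
    using emeasure_lborel_ball_finite[of "0::real^'n::_" 1] by (auto intro!: emeasure_eq_ennreal_measure simp: less_top)
  ultimately show "emeasure lborel ((*v) K ` ?B) = ennreal \<bar>det K\<bar> * emeasure lborel ?B"
    using im by (simp add: measure_completion ennreal_mult)
qed (auto simp: matrix_vector_mul_linear)

section \<open>Standard Gaussian measures\<close>

definition std_gaussian_density :: "'a::euclidean_space \<Rightarrow> real" where
  "std_gaussian_density x = 1 / sqrt ((2 * pi) ^ DIM('a)) * exp (- (x \<bullet> x) / 2)"

definition std_gaussian :: "'a::euclidean_space measure" where
  "std_gaussian = density lborel (\<lambda>x. ennreal (std_gaussian_density x))"

lemma sets_std_gaussian [simp, measurable_cong]: "sets std_gaussian = sets borel"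
  by (simp add: std_gaussian_def)

lemma space_std_gaussian [simp]: "space std_gaussian = UNIV"
  by (simp add: std_gaussian_def)

lemma std_gaussian_density_nonneg [simp]: "0 \<le> std_gaussian_density x"
  by (simp add: std_gaussian_density_def)

lemma borel_measurable_std_gaussian_density [measurable]:
  "std_gaussian_density \<in> borel_measurable borel"
  unfolding std_gaussian_density_def[abs_def] by measurable

lemma std_gaussian_density_eq_prod:
  "std_gaussian_density (x :: 'a::euclidean_space) = (\<Prod>b\<in>Basis. std_normal_density (x \<bullet> b))"
proof -
  have "(\<Prod>b\<in>Basis. std_normal_density (x \<bullet> b)) =
        (\<Prod>b\<in>(Basis::'a set). 1 / sqrt (2 * pi)) * (\<Prod>b\<in>Basis. exp (- (x \<bullet> b)\<^sup>2 / 2))"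
    by (subst prod.distrib[symmetric]) (simp add: std_normal_density_def)
  also have "(\<Prod>b\<in>Basis. exp (- (x \<bullet> b)\<^sup>2 / 2)) = exp (\<Sum>b\<in>Basis. - (x \<bullet> b)\<^sup>2 / 2)"
    by (simp add: exp_sum)
  also have "(\<Sum>b\<in>Basis. - (x \<bullet> b)\<^sup>2 / 2) = - (x \<bullet> x) / 2"
    by (subst euclidean_inner[of x x]) (simp add: sum_negf sum_divide_distrib power2_eq_square)
  also have "(\<Prod>b\<in>(Basis::'a set). 1 / sqrt (2 * pi)) = 1 / sqrt ((2 * pi) ^ DIM('a))"
    by (simp only: prod_constant power_one_over real_sqrt_power)
  finally show ?thesis by (simp add: std_gaussian_density_def)
qed

lemma nn_integral_std_gaussian_density:
  "(\<integral>\<^sup>+x. ennreal (std_gaussian_density x) \<partial>(lborel :: 'a::euclidean_space measure)) = 1"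
proof -
  interpret prob_space "density lborel (\<lambda>x. ennreal (std_normal_density x))"
    by (rule prob_space_normal_density) simp
  have "(\<integral>\<^sup>+x. ennreal (std_normal_density x) \<partial>lborel) = 1"
    using emeasure_space_1 by (simp add: emeasure_density)
  then show ?thesis
    by (simp add: std_gaussian_density_eq_prod prod_ennreal[symmetric]
          nn_integral_lborel_prod[where f = "\<lambda>b x. ennreal (std_normal_density x)"])
qed

lemma prob_space_std_gaussian: "prob_space (std_gaussian :: 'a::euclidean_space measure)"
  by (rule prob_spaceI) (simp add: std_gaussian_def emeasure_density nn_integral_std_gaussian_density)

text \<open>
  The density depends on the norm only, and Lebesgue measure is orthogonally invariant.
\<close>

lemma distr_std_gaussian_orthogonal:
  fixes f :: "'a::euclidean_space \<Rightarrow> 'a"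
  assumes f: "orthogonal_transformation f"
  shows "distr std_gaussian borel f = std_gaussian"
proof -
  have [measurable]: "f \<in> borel_measurable borel"
    using orthogonal_transformation_linear[OF f]
    by (auto intro!: borel_measurable_continuous_onI linear_continuous_on simp: linear_conv_bounded_linear)
  have "std_gaussian_density (f x) = std_gaussian_density x" for x
    using f by (simp add: std_gaussian_density_def orthogonal_transformation_def)
  then have "distr std_gaussian borel f =
      distr (density lborel (\<lambda>x. ennreal (std_gaussian_density (f x)))) borel f"
    by (simp add: std_gaussian_def)
  also have "\<dots> = density (distr lborel borel f) (\<lambda>x. ennreal (std_gaussian_density x))"
    by (rule density_distr[symmetric]) auto
  finally show ?thesis
    by (simp add: distr_lborel_orthogonal[OF f] std_gaussian_def)
qed

lemma pair_std_gaussian: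
  "(std_gaussian :: 'a::euclidean_space measure) \<Otimes>\<^sub>M (std_gaussian :: 'b::euclidean_space measure) = std_gaussian"
proof -
  interpret B: prob_space "std_gaussian :: 'b measure" by (rule prob_space_std_gaussian)
  have "(std_gaussian :: 'a measure) \<Otimes>\<^sub>M (std_gaussian :: 'b measure) =
      density (lborel \<Otimes>\<^sub>M lborel)
        (\<lambda>(x, y). ennreal (std_gaussian_density x) * ennreal (std_gaussian_density y))"
    unfolding std_gaussian_def
    using B.sigma_finite_measure_axioms
    by (intro pair_measure_density) (auto simp: std_gaussian_def lborel.sigma_finite_measure_axioms)
  also have "(\<lambda>(x :: 'a, y :: 'b). ennreal (std_gaussian_density x) * ennreal (std_gaussian_density y)) =
      (\<lambda>z. ennreal (std_gaussian_density z))"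
    by (auto simp: fun_eq_iff ennreal_mult[symmetric] std_gaussian_density_def inner_prod_def power_add
          real_sqrt_mult exp_add[symmetric] add_divide_distrib diff_divide_distrib)
  finally show ?thesis by (simp add: std_gaussian_def lborel_prod)
qed

lemma Basis_real_vec: "(Basis :: (real^'n) set) = range (\<lambda>i. axis i 1)"
  by (auto simp: Basis_vec_def)

text \<open>
  Tonelli for functions of the coordinates, indexed by the coordinates instead of by basis vectors.
\<close>

lemma nn_integral_lborel_prod_vec:
  fixes f :: "'n::finite \<Rightarrow> real \<Rightarrow> ennreal"
  assumes [measurable]: "\<And>i. f i \<in> borel_measurable borel"
  shows "(\<integral>\<^sup>+x. (\<Prod>i\<in>UNIV. f i (x $ i)) \<partial>(lborel :: (real^'n) measure)) = (\<Prod>i\<in>UNIV. \<integral>\<^sup>+x. f i x \<partial>lborel)"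
proof -
  let ?e = "\<lambda>i::'n. axis i (1::real)"
  have inj: "inj ?e" by (simp add: inj_def axis_eq_axis)
  have prod_e: "(\<Prod>b\<in>Basis. h b) = (\<Prod>i\<in>UNIV. h (?e i))" for h :: "real^'n \<Rightarrow> ennreal"
    unfolding Basis_real_vec by (subst prod.reindex[OF inj]) simp
  have inv: "the_inv ?e (?e i) = i" for i
    using inj by (rule the_inv_f_f)
  have "(\<integral>\<^sup>+x. (\<Prod>b\<in>Basis. f (the_inv ?e b) (x \<bullet> b)) \<partial>lborel) = (\<Prod>b\<in>Basis. \<integral>\<^sup>+x. f (the_inv ?e b) x \<partial>lborel)"
    by (rule nn_integral_lborel_prod) auto
  then show ?thesis
    by (simp only: prod_e inv) (simp add: inner_axis)
qed

lemma emeasure_centered_normal: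
  assumes \<sigma>: "\<sigma> > 0" and [measurable]: "A \<in> sets borel"
  shows "emeasure (density lborel (\<lambda>x. ennreal (normal_density 0 \<sigma> x))) A =
    (\<integral>\<^sup>+x. ennreal (std_normal_density x) * indicator A (\<sigma> * x) \<partial>lborel)"
proof -
  have "\<sigma> * normal_density 0 \<sigma> (\<sigma> * x) = std_normal_density x" for x
    using \<sigma> by (simp add: normal_density_def real_sqrt_mult power_mult_distrib)
  then have "ennreal \<sigma> * (ennreal (normal_density 0 \<sigma> (\<sigma> * x)) * indicator A (\<sigma> * x)) =
      ennreal (std_normal_density x) * indicator A (\<sigma> * x)" for x
    using \<sigma> by (simp add: mult.assoc[symmetric] ennreal_mult[symmetric])
  then have "(\<integral>\<^sup>+x. ennreal (std_normal_density x) * indicator A (\<sigma> * x) \<partial>lborel) =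
      \<sigma> * (\<integral>\<^sup>+x. ennreal (normal_density 0 \<sigma> (\<sigma> * x)) * indicator A (\<sigma> * x) \<partial>lborel)"
    by (subst nn_integral_cmult[symmetric]) auto
  also have "\<dots> = (\<integral>\<^sup>+x. ennreal (normal_density 0 \<sigma> x) * indicator A x \<partial>lborel)"
    using \<sigma> nn_integral_real_affine[of "\<lambda>x. ennreal (normal_density 0 \<sigma> x) * indicator A x" \<sigma> 0]
    by simp
  finally show ?thesis by (simp add: emeasure_density)
qed

text \<open>
  The unique errors are coordinatewise rescalings of a standard Gaussian vector.  It is enough to
  compare rectangles, where the Gaussian integral factorises.
\<close>

lemma PiM_centered_normal_eq_distr_std_gaussian:
  fixes \<sigma> :: "'n::finite \<Rightarrow> real"
  assumes \<sigma>: "\<And>i. \<sigma> i > 0"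
  shows "(\<Pi>\<^sub>M i\<in>UNIV. density lborel (\<lambda>x. ennreal (normal_density 0 (\<sigma> i) x))) =
    distr std_gaussian (\<Pi>\<^sub>M i\<in>UNIV. borel) (\<lambda>z i. \<sigma> i * z $ i)"
    (is "PiM UNIV ?N = ?D")
proof (rule product_sigma_finite.PiM_eqI[symmetric])
  have prob: "prob_space (?N i)" for i
    using \<sigma> by (rule prob_space_normal_density)
  show "product_sigma_finite ?N"
    using prob by (simp add: product_sigma_finite_def prob_space_imp_sigma_finite)
  show "sets ?D = sets (PiM UNIV ?N)"
    by (simp cong: sets_PiM_cong)
  fix A assume A0: "\<And>i. i \<in> UNIV \<Longrightarrow> A i \<in> sets (?N i)"
  then have A [measurable]: "A i \<in> sets borel" for i by simp
  have [measurable]: "(\<lambda>(z::real^'n) i. \<sigma> i * z $ i) \<in> borel \<rightarrow>\<^sub>M (\<Pi>\<^sub>M i\<in>UNIV. borel)"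
    by (rule measurable_PiM_single') auto
  have "emeasure ?D (Pi\<^sub>E UNIV A) = emeasure (std_gaussian :: (real^'n) measure) {z. \<forall>i. \<sigma> i * z $ i \<in> A i}"
    using A by (subst emeasure_distr) (auto intro!: arg_cong2[where f = emeasure] sets_PiM_I_finite simp: PiE_iff)
  also have "\<dots> = (\<integral>\<^sup>+z. ennreal (std_gaussian_density z) * indicator {z. \<forall>i. \<sigma> i * z $ i \<in> A i} z \<partial>lborel)"
    unfolding std_gaussian_def by (rule emeasure_density) auto
  also have "\<dots> = (\<integral>\<^sup>+z. (\<Prod>i\<in>UNIV. ennreal (std_normal_density (z $ i)) * indicator (A i) (\<sigma> i * z $ i)) \<partial>lborel)"
  proof (rule nn_integral_cong)
    fix z :: "real^'n"
    have "std_gaussian_density z = (\<Prod>i\<in>UNIV. std_normal_density (z $ i))"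
      unfolding std_gaussian_density_eq_prod Basis_real_vec
      by (subst prod.reindex) (auto simp: inj_def axis_eq_axis inner_axis)
    moreover have "indicator {z. \<forall>i. \<sigma> i * z $ i \<in> A i} z = (\<Prod>i\<in>UNIV. indicator (A i) (\<sigma> i * z $ i) :: ennreal)"
      by (auto simp: indicator_def)
    ultimately show "ennreal (std_gaussian_density z) * indicator {z. \<forall>i. \<sigma> i * z $ i \<in> A i} z =
        (\<Prod>i\<in>UNIV. ennreal (std_normal_density (z $ i)) * indicator (A i) (\<sigma> i * z $ i))"
      by (simp add: prod.distrib prod_ennreal)
  qed
  also have "\<dots> = (\<Prod>i\<in>UNIV. \<integral>\<^sup>+x. ennreal (std_normal_density x) * indicator (A i) (\<sigma> i * x) \<partial>lborel)"
    by (rule nn_integral_lborel_prod_vec) measurable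
  finally show "emeasure ?D (Pi\<^sub>E UNIV A) = (\<Prod>i\<in>UNIV. emeasure (?N i) (A i))"
    using \<sigma> by (simp add: emeasure_centered_normal)
qed simp

section \<open>The observed law depends only on its mean and covariances\<close>

lemma sym_pos_def_inner_commute:
  assumes "sym_pos_def S"
  shows "x \<bullet> (S *v y) = y \<bullet> (S *v x)"
  using assms unfolding sym_pos_def_def
  by (metis dot_lmul_matrix inner_commute transpose_matrix_vector)

text \<open>
  Gram-Schmidt for the inner product \<open>(x, y) \<mapsto> x \<bullet> (S *v y)\<close>.  A maximal orthonormal set yields a
  square root of \<open>S\<close> without the spectral theorem.
\<close>

lemma exists_conjugate_set:
  fixes S :: "real^'n^'n"
  assumes S: "sym_pos_def S" and "k \<le> CARD('n)"
  shows "\<exists>C. finite C \<and> card C = k \<and> (\<forall>x\<in>C. \<forall>y\<in>C. x \<bullet> (S *v y) = (if x = y then 1 else 0))"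
  using \<open>k \<le> CARD('n)\<close>
proof (induction k)
  case (Suc k)
  then obtain C where C: "finite C" "card C = k"
    and conj: "\<And>x y. x \<in> C \<Longrightarrow> y \<in> C \<Longrightarrow> x \<bullet> (S *v y) = (if x = y then 1 else 0)"
    by auto
  have "dim (span C) \<le> card C"
    using dim_le_card[OF _ C(1), of "span C"] by simp
  moreover have "dim (UNIV :: (real^'n) set) = CARD('n)" by simp
  ultimately have "span C \<noteq> UNIV" using C Suc.prems by force
  then obtain x where x: "x \<notin> span C" by auto
  define y where "y = x - (\<Sum>c\<in>C. (c \<bullet> (S *v x)) *\<^sub>R c)"
  have "y \<noteq> 0"
    using x by (metis (no_types, lifting) eq_iff_diff_eq_0 span_base span_scale span_sum y_def)
  then have q: "y \<bullet> (S *v y) > 0" using S by (simp add: sym_pos_def_def)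
  have Cy: "c \<bullet> (S *v y) = 0" if "c \<in> C" for c
  proof -
    have "c \<bullet> (S *v y) = c \<bullet> (S *v x) - (\<Sum>c'\<in>C. (c' \<bullet> (S *v x)) * (c \<bullet> (S *v c')))"
      by (simp add: y_def matrix_vector_mult_diff_distrib linear_sum[OF matrix_vector_mul_linear]
          matrix_vector_mult_scaleR inner_diff_right inner_sum_right)
    also have "(\<Sum>c'\<in>C. (c' \<bullet> (S *v x)) * (c \<bullet> (S *v c'))) = (\<Sum>c'\<in>C. if c = c' then c' \<bullet> (S *v x) else 0)"
      using that conj by (intro sum.cong) auto
    finally show ?thesis using that C by simp
  qed
  define z where "z = (1 / sqrt (y \<bullet> (S *v y))) *\<^sub>R y"
  have Cz: "c \<bullet> (S *v z) = 0" "z \<bullet> (S *v c) = 0" if "c \<in> C" for c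
    using Cy[OF that] sym_pos_def_inner_commute[OF S, of z c] by (simp_all add: z_def matrix_vector_mult_scaleR)
  have zz: "z \<bullet> (S *v z) = 1"
    using q by (simp add: z_def matrix_vector_mult_scaleR flip: power2_eq_square)
  then have "z \<notin> C" using Cz by auto
  then show ?case
    using C conj Cz zz by (intro exI[of _ "insert z C"]) auto
qed auto

text \<open>
  With the vectors of a full conjugate set as the rows of \<open>K\<close>, conjugacy says
  \<open>K ** S ** transpose K = mat 1\<close>, and \<open>L = S ** transpose K\<close> is the inverse of \<open>K\<close>.
\<close>

lemma sym_pos_def_obtain_factor:
  fixes S :: "real^'n^'n"
  assumes S: "sym_pos_def S"
  obtains L K :: "real^'n^'n" where "L ** K = mat 1" "K ** L = mat 1" "L ** transpose L = S"
proof -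
  obtain C where C: "finite C" "card C = CARD('n)"
    and conj: "\<And>x y. x \<in> C \<Longrightarrow> y \<in> C \<Longrightarrow> x \<bullet> (S *v y) = (if x = y then 1 else 0)"
    using exists_conjugate_set[OF S order_refl] by auto
  obtain e :: "'n \<Rightarrow> real^'n" where e: "bij_betw e UNIV C"
    using C by (metis finite_same_card_bij finite_class.finite_UNIV)
  define K :: "real^'n^'n" where "K = (\<chi> i. e i)"
  define L where "L = S ** transpose K"
  have "(K ** (S ** transpose K)) $ i $ j = e i \<bullet> (S *v e j)" for i j
    by (simp add: K_def matrix_matrix_mult_def matrix_vector_mult_def transpose_def inner_vec_def)
  moreover have "e i \<bullet> (S *v e j) = (if i = j then 1 else 0)" for i j
    using e conj[of "e i" "e j"] by (auto simp: bij_betw_def inj_on_eq_iff)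
  ultimately have KL: "K ** L = mat 1"
    by (simp add: L_def vec_eq_iff mat_def)
  then have LK: "L ** K = mat 1" by (simp add: matrix_left_right_inverse)
  have "L ** transpose L = L ** (K ** S)"
    using S by (simp add: L_def matrix_transpose_mul sym_pos_def_def)
  then have "L ** transpose L = S" by (simp add: matrix_mul_assoc LK)
  with LK KL show ?thesis by (rule that)
qed

lemma matrix_inv_eqI:
  fixes M N :: "real^'n^'n"
  assumes "M ** N = mat 1" "N ** M = mat 1"
  shows "matrix_inv M = N"
proof -
  have "M ** matrix_inv M = mat 1"
    unfolding matrix_inv_def using assms someI[of "\<lambda>N. M ** N = mat 1 \<and> N ** M = mat 1" N] by simp
  then have "N ** (M ** matrix_inv M) = N" by simp
  then show ?thesis by (simp add: matrix_mul_assoc assms)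
qed

text \<open>
  The normalising constant of the multivariate normal density is the Jacobian factor of the linear
  map: the determinant of \<open>L ** transpose L\<close> is the square of that of \<open>L\<close>.
\<close>

lemma mvnormal_eq_distr_std_gaussian:
  fixes L K :: "real^'n::{finite,wellorder}^'n::_"
  assumes LK: "L ** K = mat 1" and KL: "K ** L = mat 1"
  shows "mvnormal 0 (L ** transpose L) = distr std_gaussian borel ((*v) L)"
proof -
  have [measurable]: "(*v) M \<in> borel_measurable borel" for M :: "real^'n::_^'n::_"
    by (intro borel_measurable_continuous_onI linear_continuous_on matrix_vector_mul_bounded_linear)
  have "transpose K ** transpose L = mat 1" "transpose L ** transpose K = mat 1"
    by (simp_all flip: matrix_transpose_mul add: LK KL)
  then have "(L ** transpose L) ** (transpose K ** K) = mat 1" "(transpose K ** K) ** (L ** transpose L) = mat 1"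
    by (metis LK KL matrix_mul_assoc matrix_mul_rid)+
  then have inv: "matrix_inv (L ** transpose L) = transpose K ** K"
    by (rule matrix_inv_eqI)
  have quad: "x \<bullet> (matrix_inv (L ** transpose L) *v x) = (K *v x) \<bullet> (K *v x)" for x
    unfolding inv by (metis dot_lmul_matrix matrix_vector_mul_assoc transpose_matrix_vector transpose_transpose)
  have "det L * det K = 1" by (metis LK det_I det_mul)
  then have "det L \<noteq> 0" "\<bar>det L\<bar> * \<bar>det K\<bar> = 1"
    by (auto simp flip: abs_mult)
  then have detL: "det L \<noteq> 0" "\<bar>det K\<bar> = 1 / \<bar>det L\<bar>"
    by (auto simp: field_simps)
  have dens: "mvnormal_density 0 (L ** transpose L) x = \<bar>det K\<bar> * std_gaussian_density (K *v x)" for x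
  proof -
    have "sqrt ((2 * pi) ^ CARD('n) * det (L ** transpose L)) = sqrt ((2 * pi) ^ CARD('n)) * \<bar>det L\<bar>"
      by (simp add: det_mul det_transpose real_sqrt_mult)
    then show ?thesis
      by (simp add: mvnormal_density_def std_gaussian_density_def quad detL)
  qed
  have "mvnormal 0 (L ** transpose L) =
      density lborel (\<lambda>x. ennreal \<bar>det K\<bar> * ennreal (std_gaussian_density (K *v x)))"
    unfolding mvnormal_def dens by (simp add: ennreal_mult)
  also have "\<dots> = density (density lborel (\<lambda>_. ennreal \<bar>det K\<bar>)) (\<lambda>x. ennreal (std_gaussian_density (K *v x)))"
    by (rule density_density_eq[symmetric]) auto
  also have "\<dots> = density (distr lborel borel ((*v) L)) (\<lambda>x. ennreal (std_gaussian_density (K *v x)))"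
    by (simp add: distr_lborel_matrix[OF LK KL])
  also have "\<dots> = distr (density lborel (\<lambda>x. ennreal (std_gaussian_density (K *v (L *v x))))) borel ((*v) L)"
    by (rule density_distr) auto
  finally show ?thesis
    by (simp add: matrix_vector_mul_assoc KL std_gaussian_def)
qed

text \<open>
  Insert the vectors one at a time.  If \<open>g\<close> already moves the earlier vectors correctly, compose it
  with the reflection in the hyperplane orthogonal to \<open>w = g (u k) - v k\<close>: it sends \<open>g (u k)\<close> to \<open>v k\<close>
  because both have the same norm, and fixes each earlier \<open>v i\<close> because equality of the Gram entries
  makes \<open>v i\<close> orthogonal to \<open>w\<close>.
\<close>

lemma equal_gram_imp_orthogonal_image:
  fixes u v :: "'i \<Rightarrow> 'a::euclidean_space"
  assumes "finite I" "\<And>i j. i \<in> I \<Longrightarrow> j \<in> I \<Longrightarrow> u i \<bullet> u j = v i \<bullet> v j"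
  shows "\<exists>g. orthogonal_transformation g \<and> (\<forall>i\<in>I. g (u i) = v i)"
  using assms
proof (induction I)
  case empty
  then show ?case by (intro exI[of _ "\<lambda>x. x"]) auto
next
  case (insert k I)
  then obtain g where g: "orthogonal_transformation g" and gu: "\<And>i. i \<in> I \<Longrightarrow> g (u i) = v i"
    by auto
  have g_inner: "g x \<bullet> g y = x \<bullet> y" for x y
    using g by (simp add: orthogonal_transformation_def)
  define w where "w = g (u k) - v k"
  \<comment> \<open>For \<open>w = 0\<close> this is the identity, since division by zero yields zero.\<close>
  define r where "r x = x - (2 * (x \<bullet> w) / (w \<bullet> w)) *\<^sub>R w" for x
  have "linear r"
    by (rule linearI) (simp_all add: r_def inner_add_left algebra_simps add_divide_distrib)
  moreover have "r x \<bullet> r y = x \<bullet> y" for x y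
    by (cases "w = 0") (auto simp: r_def inner_diff_left inner_diff_right inner_commute field_simps)
  ultimately have r: "orthogonal_transformation r"
    by (simp add: orthogonal_transformation_def)
  have "v i \<bullet> w = 0" if "i \<in> I" for i
    using insert.prems[of i k] gu[OF that] g_inner[of "u i" "u k"] that
    by (simp add: w_def inner_diff_right)
  then have "r (g (u i)) = v i" if "i \<in> I" for i
    using that gu by (simp add: r_def)
  moreover have "r (g (u k)) = v k"
  proof -
    have "2 * (g (u k) \<bullet> w) = w \<bullet> w"
      using insert.prems[of k k] g_inner[of "u k" "u k"]
      by (simp add: w_def inner_diff_left inner_diff_right inner_commute)
    then show ?thesis
      by (cases "w = 0") (simp_all add: r_def, simp_all add: w_def)
  qed
  ultimately show ?case
    using orthogonal_transformation_compose[OF r g]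
    by (intro exI[of _ "r \<circ> g"]) (auto simp: o_def)
qed

definition affine_image :: "real^'n \<Rightarrow> ('n \<Rightarrow> 'a) \<Rightarrow> 'a::euclidean_space \<Rightarrow> real^'n" where
  "affine_image d m x = d + (\<chi> j. m j \<bullet> x)"

lemma borel_measurable_vecI:
  fixes f :: "'a \<Rightarrow> real^'n"
  assumes "\<And>i. (\<lambda>x. f x $ i) \<in> borel_measurable M"
  shows "f \<in> borel_measurable M"
  using assms by (subst borel_measurable_euclidean_space) (auto simp: Basis_real_vec inner_axis)

lemma borel_measurable_affine_image [measurable]: "affine_image d m \<in> borel_measurable borel"
  by (rule borel_measurable_vecI) (simp add: affine_image_def)

text \<open>
  A linear image of a standard Gaussian depends only on the Gram matrix of the coefficient vectors,
  that is, on the covariance matrix of the image.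
\<close>

lemma distr_std_gaussian_affine_image_cong:
  fixes m m' :: "'n::finite \<Rightarrow> 'a::euclidean_space"
  assumes "\<And>i j. m i \<bullet> m j = m' i \<bullet> m' j"
  shows "distr std_gaussian borel (affine_image d m) = distr std_gaussian borel (affine_image d m')"
proof -
  obtain g where g: "orthogonal_transformation g" and gm: "\<And>i. g (m i) = m' i"
    using equal_gram_imp_orthogonal_image[of UNIV m m'] assms by auto
  have [measurable]: "g \<in> borel_measurable borel"
    using orthogonal_transformation_linear[OF g]
    by (auto intro!: borel_measurable_continuous_onI linear_continuous_on simp: linear_conv_bounded_linear)
  have "m' i \<bullet> g x = m i \<bullet> x" for i x
    using g gm[of i] unfolding orthogonal_transformation_def by metis
  then have "affine_image d m = affine_image d m' \<circ> g"
    by (simp add: affine_image_def fun_eq_iff)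
  then have "distr std_gaussian borel (affine_image d m) = distr (distr std_gaussian borel g) borel (affine_image d m')"
    by (simp add: distr_distr)
  then show ?thesis by (simp add: distr_std_gaussian_orthogonal[OF g])
qed

lemma sym_pos_def_factor_cov:
  fixes S :: "real^'g^'g"
  assumes S: "sym_pos_def S"
  shows "sym_pos_def (factor_cov S)"
proof -
  have sum_option: "(\<Sum>c\<in>UNIV. f c) = f None + (\<Sum>g\<in>UNIV. f (Some g))" for f :: "'g option \<Rightarrow> real"
    by (simp add: UNIV_option_conv sum.reindex)
  have "S $ g $ h = S $ h $ g" for g h
    using S unfolding sym_pos_def_def transpose_def by (metis vec_lambda_beta)
  then have "transpose (factor_cov S) = factor_cov S"
    by (auto simp: factor_cov_def transpose_def vec_eq_iff split: option.splits)
  moreover have "x \<bullet> (factor_cov S *v x) > 0" if "x \<noteq> 0" for x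
  proof -
    let ?y = "\<chi> g. x $ Some g"
    have eq: "x \<bullet> (factor_cov S *v x) = (x $ None)\<^sup>2 + ?y \<bullet> (S *v ?y)"
      by (simp add: inner_vec_def matrix_vector_mult_def sum_option factor_cov_def power2_eq_square)
    show ?thesis
    proof (cases "?y = 0")
      case True
      then have "x $ None \<noteq> 0"
        using that by (auto simp: vec_eq_iff) (metis option.exhaust)
      with True eq show ?thesis by simp
    next
      case False
      then have "?y \<bullet> (S *v ?y) > 0" using S unfolding sym_pos_def_def by blast
      then show ?thesis unfolding eq by (simp add: add_nonneg_pos)
    qed
  qed
  ultimately show ?thesis by (simp add: sym_pos_def_def)
qed

definition observed_cov ::
  "('j::finite \<Rightarrow> 'g::finite) \<Rightarrow> real^('g option)^'j \<Rightarrow> real^'g^'g \<Rightarrow> real^'j \<Rightarrow> 'j \<Rightarrow> 'j \<Rightarrow> real" where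
  "observed_cov t A S l i j =
     A $ i $ None * A $ j $ None + A $ i $ Some (t i) * A $ j $ Some (t j) * S $ t i $ t j
     + (if i = j then l $ i else 0)"

text \<open>
  With \<open>factor_cov S = L ** transpose L\<close>, the factors are \<open>L *v x\<close> and the errors are \<open>sqrt (l $ j) * y $ j\<close>
  for independent standard Gaussians \<open>x\<close> and \<open>y\<close>.  The space of \<open>(x, y)\<close> has the same dimension for
  all parameters, so that different parameters can be compared by an orthogonal map.
\<close>

lemma bifactor_law_std_gaussian:
  fixes t :: "'j::finite \<Rightarrow> 'g::{finite,wellorder}" and S :: "real^'g::_^'g::_"
  assumes S: "sym_pos_def S" and l: "\<And>j. l $ j > 0"
  obtains m :: "'j \<Rightarrow> (real^('g option)) \<times> (real^'j)" where
    "bifactor_law t A d S l = distr std_gaussian borel (affine_image d m)"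
    "\<And>i j. m i \<bullet> m j = observed_cov t A S l i j"
proof -
  obtain L K :: "real^('g option)^('g option)"
    where LK: "L ** K = mat 1" "K ** L = mat 1" and LL: "L ** transpose L = factor_cov S"
    using sym_pos_def_obtain_factor[OF sym_pos_def_factor_cov[OF S]] by metis
  \<comment> \<open>The row of the loading matrix for item \<open>j\<close>, restricted to the two factors that enter \<open>observed\<close>.\<close>
  define a :: "'j \<Rightarrow> real^('g option)" where
    "a j = axis None (A $ j $ None) + axis (Some (t j)) (A $ j $ Some (t j))" for j
  define m where "m j = (transpose L *v a j, axis j (sqrt (l $ j)))" for j
  let ?h = "\<lambda>(z::real^'j) j. sqrt (l $ j) * z $ j"
  let ?P = "PiM UNIV (\<lambda>_. borel) :: ('j \<Rightarrow> real) measure"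
  let ?N = "\<Pi>\<^sub>M j\<in>UNIV. density lborel (\<lambda>x. ennreal (normal_density 0 (sqrt (l $ j)) x))"
  have [measurable]: "(*v) L \<in> borel_measurable borel"
    by (intro borel_measurable_continuous_onI linear_continuous_on matrix_vector_mul_bounded_linear)
  have [measurable]: "?h \<in> borel \<rightarrow>\<^sub>M ?P"
    by (rule measurable_PiM_single') auto
  have [measurable]: "(\<lambda>x. snd x i) \<in> borel_measurable ((borel :: (real^('g option)) measure) \<Otimes>\<^sub>M ?P)" for i
    by (rule measurable_compose[OF measurable_snd measurable_component_singleton]) simp
  have [measurable]: "(\<lambda>x. fst x $ c) \<in> borel_measurable ((borel :: (real^('g option)) measure) \<Otimes>\<^sub>M ?P)" for c
    by (rule measurable_compose[OF measurable_fst]) simp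
  have [measurable]: "observed t A d \<in> borel \<Otimes>\<^sub>M ?P \<rightarrow>\<^sub>M borel"
  proof (rule borel_measurable_vecI)
    fix i
    show "(\<lambda>x. observed t A d x $ i) \<in> borel_measurable (borel \<Otimes>\<^sub>M ?P)"
      unfolding observed_def split_beta vec_lambda_beta by measurable
  qed
  have N: "?N = distr std_gaussian ?P ?h"
    using l by (intro PiM_centered_normal_eq_distr_std_gaussian) simp
  have F: "mvnormal 0 (factor_cov S) = distr std_gaussian borel ((*v) L)"
    unfolding LL[symmetric] by (rule mvnormal_eq_distr_std_gaussian[OF LK])
  interpret D: prob_space "distr std_gaussian ?P ?h"
    by (intro prob_space.prob_space_distr prob_space_std_gaussian) simp
  have "mvnormal 0 (factor_cov S) \<Otimes>\<^sub>M ?N =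
      distr (std_gaussian \<Otimes>\<^sub>M std_gaussian) (borel \<Otimes>\<^sub>M ?P) (\<lambda>(x, y). (L *v x, ?h y))"
    unfolding F N by (rule pair_measure_distr) (auto simp: D.sigma_finite_measure_axioms)
  then have "bifactor_law t A d S l = distr (std_gaussian \<Otimes>\<^sub>M std_gaussian) borel
      (observed t A d \<circ> (\<lambda>(x, y). (L *v x, ?h y)))"
    unfolding bifactor_law_def by (simp add: distr_distr)
  also have "observed t A d \<circ> (\<lambda>(x, y). (L *v x, ?h y)) = affine_image d m"
  proof -
    have "(transpose L *v a j) \<bullet> x = a j \<bullet> (L *v x)" for j x
      by (simp add: transpose_matrix_vector dot_lmul_matrix)
    then show ?thesis
      by (auto simp: fun_eq_iff vec_eq_iff observed_def affine_image_def m_def a_def inner_add_left inner_axis')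
  qed
  finally have "bifactor_law t A d S l = distr std_gaussian borel (affine_image d m)"
    by (simp add: pair_std_gaussian)
  moreover have "m i \<bullet> m j = observed_cov t A S l i j" for i j
  proof -
    have "(transpose L *v a i) \<bullet> (transpose L *v a j) = a i \<bullet> (factor_cov S *v a j)"
      by (simp add: transpose_matrix_vector dot_lmul_matrix matrix_vector_mul_assoc flip: LL)
         (metis matrix_vector_mul_assoc transpose_matrix_vector)
    also have "\<dots> = A $ i $ None * A $ j $ None + A $ i $ Some (t i) * A $ j $ Some (t j) * S $ t i $ t j"
    proof -
      have "factor_cov S *v axis c x = (\<chi> b. factor_cov S $ b $ c * x)" for c x
        by (simp add: vec_eq_iff matrix_vector_mult_def axis_def if_distrib cong: if_cong)
      then show ?thesis
        by (simp add: a_def inner_add_left inner_add_right matrix_vector_right_distrib inner_axis' factor_cov_def)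
    qed
    finally show ?thesis
      using l[of i] by (auto simp: m_def observed_cov_def inner_axis_axis)
  qed
  ultimately show ?thesis by (rule that)
qed

lemma bifactor_law_cong:
  fixes t :: "'j::finite \<Rightarrow> 'g::{finite,wellorder}" and S S' :: "real^'g::_^'g::_"
  assumes "sym_pos_def S" "\<And>j. l $ j > 0" "sym_pos_def S'" "\<And>j. l' $ j > 0"
    and "\<And>i j. observed_cov t A' S' l' i j = observed_cov t A S l i j"
  shows "bifactor_law t A' d S' l' = bifactor_law t A d S l"
  using bifactor_law_std_gaussian[OF assms(1,2), of t A d]
    bifactor_law_std_gaussian[OF assms(3,4), of t A' d] assms(5)
  by (metis distr_std_gaussian_affine_image_cong)

section \<open>Positive definite covariances of combined factors\<close>

text \<open>
  \<open>S'\<close> is the covariance matrix of the variables \<open>v g \<zeta> + b g \<bullet> \<eta>\<close>, where \<open>\<eta>\<close> has covariance \<open>S\<close> and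
  \<open>\<zeta>\<close> is an independent variable of unit variance; the last hypothesis says that these variables are
  linearly independent.
\<close>

lemma sym_pos_def_congruence_plus_square:
  fixes S S' :: "real^'g^'g" and v :: "'g \<Rightarrow> real" and b :: "'g \<Rightarrow> real^'g"
  assumes S: "sym_pos_def S"
    and S': "\<And>g h. S' $ g $ h = v g * v h + b g \<bullet> (S *v b h)"
    and inj: "\<And>x. (\<Sum>g\<in>UNIV. x $ g * v g) = 0 \<Longrightarrow> (\<Sum>g\<in>UNIV. x $ g *\<^sub>R b g) = 0 \<Longrightarrow> x = 0"
  shows "sym_pos_def S'"
  unfolding sym_pos_def_def
proof (intro conjI allI impI)
  show "transpose S' = S'"
    using sym_pos_def_inner_commute[OF S] by (simp add: vec_eq_iff transpose_def S' mult.commute)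
  fix x :: "real^'g" assume "x \<noteq> 0"
  let ?s = "\<Sum>g\<in>UNIV. x $ g * v g" and ?w = "\<Sum>g\<in>UNIV. x $ g *\<^sub>R b g"
  have "?w \<bullet> (S *v ?w) = (\<Sum>h\<in>UNIV. \<Sum>g\<in>UNIV. x $ g * x $ h * (b g \<bullet> (S *v b h)))"
    by (simp add: linear_sum[OF matrix_vector_mul_linear] matrix_vector_mult_scaleR inner_sum_left
        inner_sum_right sum_distrib_left ac_simps)
  also have "\<dots> = (\<Sum>g\<in>UNIV. \<Sum>h\<in>UNIV. x $ g * x $ h * (b g \<bullet> (S *v b h)))"
    by (rule sum.swap)
  finally have "?w \<bullet> (S *v ?w) = (\<Sum>g\<in>UNIV. \<Sum>h\<in>UNIV. x $ g * x $ h * (b g \<bullet> (S *v b h)))" .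
  moreover have "?s\<^sup>2 = (\<Sum>g\<in>UNIV. \<Sum>h\<in>UNIV. x $ g * x $ h * (v g * v h))"
    by (simp add: power2_eq_square sum_product ac_simps)
  moreover have "x \<bullet> (S' *v x) = (\<Sum>g\<in>UNIV. \<Sum>h\<in>UNIV. x $ g * x $ h * (v g * v h + b g \<bullet> (S *v b h)))"
    by (simp add: inner_vec_def matrix_vector_mult_def S' sum_distrib_left ac_simps)
  ultimately have eq: "x \<bullet> (S' *v x) = ?s\<^sup>2 + ?w \<bullet> (S *v ?w)"
    by (simp add: distrib_left sum.distrib)
  show "x \<bullet> (S' *v x) > 0"
  proof (cases "?w = 0")
    case True
    then have "?s \<noteq> 0" using inj \<open>x \<noteq> 0\<close> by blast
    with True eq show ?thesis by simp
  next
    case False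
    then have "?w \<bullet> (S *v ?w) > 0" using S unfolding sym_pos_def_def by blast
    then show ?thesis unfolding eq by (simp add: add_nonneg_pos)
  qed
qed

text \<open>
  The case where the \<open>g\<close>-th variable is \<open>r g \<eta> g + v g \<zeta>\<close>.  At most one of the factors may be replaced
  entirely by \<open>\<zeta>\<close>.
\<close>

lemma sym_pos_def_rescale_plus_square:
  fixes S S' :: "real^'g^'g" and v r :: "'g \<Rightarrow> real"
  assumes S: "sym_pos_def S"
    and S': "\<And>g h. S' $ g $ h = v g * v h + r g * r h * S $ g $ h"
    and r: "\<And>g. g \<noteq> k \<Longrightarrow> r g \<noteq> 0" "r k \<noteq> 0 \<or> v k \<noteq> 0"
  shows "sym_pos_def S'"
proof (rule sym_pos_def_congruence_plus_square[OF S, where v = v and b = "\<lambda>g. axis g (r g)"])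
  fix g h
  have "axis g (r g) \<bullet> (S *v axis h (r h)) = r g * r h * S $ g $ h"
  proof -
    have "S *v axis h (r h) = (\<chi> b. S $ b $ h * r h)"
      by (simp add: vec_eq_iff matrix_vector_mult_def axis_def if_distrib cong: if_cong)
    then show ?thesis by (simp add: inner_axis')
  qed
  then show "S' $ g $ h = v g * v h + axis g (r g) \<bullet> (S *v axis h (r h))" by (simp add: S')
next
  fix x :: "real^'g"
  assume 1: "(\<Sum>g\<in>UNIV. x $ g * v g) = 0" and 2: "(\<Sum>g\<in>UNIV. x $ g *\<^sub>R axis g (r g)) = 0"
  have "(\<Sum>g\<in>UNIV. x $ g *\<^sub>R axis g (r g)) $ h = x $ h * r h" for h
    by (simp add: axis_def if_distrib cong: if_cong)
  then have xr: "x $ h * r h = 0" for h using 2 by (metis zero_index)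
  then have "x $ g = 0" if "g \<noteq> k" for g using r(1) that by auto
  moreover from this have "(\<Sum>g\<in>UNIV. x $ g * v g) = (\<Sum>g\<in>UNIV. if g = k then x $ k * v k else 0)"
    by (intro sum.cong) auto
  with 1 have "x $ k * v k = 0" by simp
  with xr[of k] r(2) have "x $ k = 0" by auto
  ultimately show "x = 0" by (metis vec_eq_iff zero_index)
qed

section \<open>Identifiability up to signs\<close>

text \<open>
  The parameter space without the sign constraints on the loading columns.
\<close>

definition model_params ::
  "('j::finite \<Rightarrow> 'g::finite) \<Rightarrow> real^('g option)^'j \<Rightarrow> real^'g^'g \<Rightarrow> real^'j \<Rightarrow> bool" where
  "model_params t A S l \<longleftrightarrow>
     (\<forall>j g. g \<noteq> t j \<longrightarrow> A $ j $ Some g = 0) \<and>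
     sym_pos_def S \<and> (\<forall>g. S $ g $ g = 1) \<and> (\<forall>j. l $ j > 0)"

text \<open>
  Flipping the sign of a factor and of its loading column leaves the covariances unchanged, so every
  alternative parameter can be brought into the parameter space.  This removes the sign
  constraints from the constructions of alternatives below.
\<close>

lemma identifiable_up_to_signs:
  fixes t :: "'j::{finite,wellorder} \<Rightarrow> 'g::{finite,wellorder}"
    and A A' :: "real^('g option)^'j::_" and d :: "real^'j::_"
    and S S' :: "real^'g::_^'g::_" and l l' :: "real^'j::_"
  assumes P: "param_space t A d S l" and I: "identifiable_at t A d S l"
    and M: "model_params t A' S' l'"
    and cov: "\<And>i j. observed_cov t A' S' l' i j = observed_cov t A S l i j"
  shows "l' = l" "\<exists>s\<in>{1, -1}. \<forall>j. A' $ j $ c = s * A $ j $ c"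
proof -
  define s :: "'g option \<Rightarrow> real" where
    "s c = (if \<exists>j. A' $ j $ c < 0 \<and> (\<forall>i<j. A' $ i $ c = 0) then -1 else 1)" for c
  have s: "s c \<in> {1, -1}" "s c * s c = 1" "s c * (s c * x) = x" for c x by (auto simp: s_def)
  define A'' :: "real^('g option)^'j::_" where "A'' = (\<chi> j c. s c * A' $ j $ c)"
  define S'' :: "real^'g::_^'g::_" where "S'' = (\<chi> g h. s (Some g) * s (Some h) * S' $ g $ h)"
  have s0: "s c \<noteq> 0" for c by (auto simp: s_def)
  have S'': "sym_pos_def S''"
    using M s0 by (intro sym_pos_def_rescale_plus_square[of S' S'' "\<lambda>_. 0" "\<lambda>g. s (Some g)" undefined])
      (auto simp: model_params_def S''_def)
  have "observed_cov t A'' S'' l' i j = observed_cov t A' S' l' i j" for i j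
    by (simp add: observed_cov_def A''_def S''_def s ac_simps)
  then have law: "bifactor_law t A'' d S'' l' = bifactor_law t A d S l"
    using P M S'' cov by (intro bifactor_law_cong) (auto simp: param_space_def model_params_def)
  have "A'' $ j $ c > 0" if "A'' $ j $ c \<noteq> 0" "\<forall>i<j. A'' $ i $ c = 0" for j c
  proof -
    have A': "A' $ j $ c \<noteq> 0" "\<forall>i<j. A' $ i $ c = 0"
      using that s0 by (auto simp: A''_def)
    show ?thesis
    proof (cases "A' $ j $ c < 0")
      case True
      then have "s c = -1" using A' by (auto simp: s_def)
      with True show ?thesis by (simp add: A''_def)
    next
      case False
      have "s c = 1"
      proof (rule ccontr)
        assume "s c \<noteq> 1"
        then obtain k where k: "A' $ k $ c < 0" "\<forall>i<k. A' $ i $ c = 0"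
          by (auto simp: s_def split: if_splits)
        with A' False show False
          by (metis less_irrefl linorder_cases)
      qed
      with False A' show ?thesis by (simp add: A''_def)
    qed
  qed
  then have "param_space t A'' d S'' l'"
    using M S'' s by (auto simp: param_space_def model_params_def A''_def S''_def)
  with law I have eq: "A'' = A" "l' = l" by (auto simp: identifiable_at_def)
  show "l' = l" by fact
  have "A' $ j $ c = s c * A $ j $ c" for j
    by (simp add: eq(1)[symmetric] A''_def s)
  with s(1) show "\<exists>s\<in>{1, -1}. \<forall>j. A' $ j $ c = s * A $ j $ c" by blast
qed

lemma param_space_imp_model_params:
  "param_space t A d S l \<Longrightarrow> model_params t A S l"
  by (simp add: param_space_def model_params_def)

lemma model_params_sym:
  "model_params t A S l \<Longrightarrow> S $ g $ h = S $ h $ g"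
  unfolding model_params_def sym_pos_def_def transpose_def by (metis vec_lambda_beta)

section \<open>The number of items loading on a testlet factor\<close>

text \<open>
  If nothing loads on factor \<open>g\<close>, decorrelate it and let it explain half of the unique variance of a
  single item.
\<close>

lemma identifiable_imp_Q_set_nonempty:
  fixes t :: "'j::{finite,wellorder} \<Rightarrow> 'g::{finite,wellorder}"
    and A :: "real^('g option)^'j::_" and d :: "real^'j::_"
    and S :: "real^'g::_^'g::_" and l :: "real^'j::_"
  assumes "surj t" and P: "param_space t A d S l" and I: "identifiable_at t A d S l"
  shows "Q_set A g \<noteq> {}"
proof
  assume "Q_set A g = {}"
  then have A0: "A $ i $ Some g = 0" for i by (auto simp: Q_set_def)
  obtain j where j: "t j = g" using \<open>surj t\<close> by (metis surjD)
  note M = param_space_imp_model_params[OF P, unfolded model_params_def]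
  define e where "e = sqrt (l $ j / 2)"
  have e: "e \<noteq> 0" "e * e = l $ j / 2"
    using M by (simp_all add: e_def order_less_imp_le) (metis less_irrefl)
  define A' :: "real^('g option)^'j::_" where
    "A' = (\<chi> i c. if i = j \<and> c = Some g then e else A $ i $ c)"
  define l' :: "real^'j::_" where "l' = (\<chi> i. if i = j then l $ j / 2 else l $ i)"
  define S' :: "real^'g::_^'g::_" where
    "S' = (\<chi> a b. if a = b then 1 else if a = g \<or> b = g then 0 else S $ a $ b)"
  have "sym_pos_def S'"
    using M by (intro sym_pos_def_rescale_plus_square[of S S' "\<lambda>a. if a = g then 1 else 0"
          "\<lambda>a. if a = g then 0 else 1" g]) (auto simp: S'_def)
  then have M': "model_params t A' S' l'"
    using M j by (auto simp: model_params_def A'_def S'_def l'_def)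
  have "observed_cov t A' S' l' i k = observed_cov t A S l i k" for i k
    using j e A0 M by (auto simp: observed_cov_def A'_def S'_def l'_def)
  from identifiable_up_to_signs(2)[OF P I M' this, of "Some g"]
  have "A' $ j $ Some g = 0" using A0 by auto
  then show False using e by (simp add: A'_def)
qed

text \<open>
  Scaling the loading \<open>\<alpha>\<close> by \<open>c\<close> moves half of the unique variance \<open>v\<close> into the common part.
\<close>

lemma loading_inflation_factor:
  fixes \<alpha> v :: real
  assumes "\<alpha> \<noteq> 0" "v > 0"
  obtains c where "c > 0" "c * c > 1" "c * \<alpha> * (c * \<alpha>) = \<alpha> * \<alpha> + v / 2"
proof -
  define c where "c = sqrt (1 + v / (2 * \<alpha>\<^sup>2))"
  have c2: "c * c = 1 + v / (2 * \<alpha>\<^sup>2)"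
    using assms by (simp add: c_def)
  have "c > 0" "c * c > 1"
    using assms by (auto simp: c2) (simp add: c_def add_pos_pos)
  moreover have "(c * c) * (\<alpha> * \<alpha>) = \<alpha> * \<alpha> + v / 2"
    unfolding c2 using assms(1) by (simp add: field_simps power2_eq_square)
  then have "c * \<alpha> * (c * \<alpha>) = \<alpha> * \<alpha> + v / 2" by (simp only: ac_simps)
  ultimately show ?thesis by (rule that)
qed

text \<open>
  A single loading enters the off-diagonal covariances only through its products with the correlations
  of the factor.
\<close>

lemma identifiable_imp_Q_set_not_singleton:
  fixes t :: "'j::{finite,wellorder} \<Rightarrow> 'g::{finite,wellorder}"
    and A :: "real^('g option)^'j::_" and d :: "real^'j::_"
    and S :: "real^'g::_^'g::_" and l :: "real^'j::_"
  assumes P: "param_space t A d S l" and I: "identifiable_at t A d S l"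
  shows "Q_set A g \<noteq> {j}"
proof
  assume Q: "Q_set A g = {j}"
  then have A0: "A $ j $ Some g \<noteq> 0" "\<And>i. i \<noteq> j \<Longrightarrow> A $ i $ Some g = 0" by (auto simp: Q_set_def)
  note M = param_space_imp_model_params[OF P, unfolded model_params_def]
  have j: "t j = g" using M A0 by metis
  define \<alpha> where "\<alpha> = A $ j $ Some g"
  have lj: "l $ j > 0" and \<alpha>: "\<alpha> \<noteq> 0" using M A0 by (auto simp: \<alpha>_def)
  obtain c where c: "c > 0" "c * c > 1" and c\<alpha>: "c * \<alpha> * (c * \<alpha>) = \<alpha> * \<alpha> + l $ j / 2"
    using loading_inflation_factor[OF \<alpha> lj] by blast
  define A' :: "real^('g option)^'j::_" where
    "A' = (\<chi> i b. if b = Some g then c * A $ i $ b else A $ i $ b)"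
  define l' :: "real^'j::_" where "l' = (\<chi> i. if i = j then l $ j / 2 else l $ i)"
  define S' :: "real^'g::_^'g::_" where
    "S' = (\<chi> a b. if a = b then 1 else if a = g \<or> b = g then S $ a $ b / c else S $ a $ b)"
  have "1 - 1 / (c * c) \<ge> 0" using c by simp
  then have "sqrt (1 - 1 / (c * c)) * sqrt (1 - 1 / (c * c)) = 1 - 1 / (c * c)" by simp
  then have "sym_pos_def S'"
    using M c by (intro sym_pos_def_rescale_plus_square[of S S' "\<lambda>a. if a = g then sqrt (1 - 1 / (c * c)) else 0"
          "\<lambda>a. if a = g then 1 / c else 1" g]) (auto simp: S'_def)
  then have M': "model_params t A' S' l'"
    using M j by (auto simp: model_params_def A'_def S'_def l'_def)
  have "observed_cov t A' S' l' i k = observed_cov t A S l i k" for i k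
  proof -
    have A'j: "A' $ j $ Some g = c * \<alpha>" "A' $ j $ None = A $ j $ None"
      by (simp_all add: A'_def \<alpha>_def)
    have A'i: "A' $ i $ b = A $ i $ b" if "i \<noteq> j" for i b
      using A0(2)[OF that] by (simp add: A'_def)
    have S'gg: "S' $ g $ g = 1" and Sgg: "S $ g $ g = 1"
      using M by (simp_all add: S'_def)
    have S'g: "S' $ g $ b = S $ g $ b / c" "S' $ b $ g = S $ b $ g / c" if "b \<noteq> g" for b
      using that by (simp_all add: S'_def)
    have S'n: "S' $ a $ b = S $ a $ b" if "a \<noteq> g" "b \<noteq> g" for a b
      using that M by (simp add: S'_def)
    show ?thesis
      by (cases "i = j"; cases "k = j"; cases "t i = g"; cases "t k = g")
        (use c in \<open>simp_all add: observed_cov_def A'j A'i S'g S'n A0(2) j l'_def S'gg Sgg c\<alpha> flip: \<alpha>_def\<close>)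
  qed
  from identifiable_up_to_signs(1)[OF P I M' this] have "l' $ j = l $ j" by simp
  then show False using lj by (simp add: l'_def)
qed

text \<open>
  Two loadings on an otherwise uncorrelated factor enter the off-diagonal covariances only through
  their product; the diagonal is repaired by the unique variances.
\<close>

lemma identifiable_imp_Q_set_not_pair:
  fixes t :: "'j::{finite,wellorder} \<Rightarrow> 'g::{finite,wellorder}"
    and A :: "real^('g option)^'j::_" and d :: "real^'j::_"
    and S :: "real^'g::_^'g::_" and l :: "real^'j::_"
  assumes P: "param_space t A d S l" and I: "identifiable_at t A d S l"
    and S0: "\<And>h. h \<noteq> g \<Longrightarrow> S $ g $ h = 0" and ij: "i \<noteq> j"
  shows "Q_set A g \<noteq> {i, j}"
proof
  assume Q: "Q_set A g = {i, j}"
  then have A0: "A $ i $ Some g \<noteq> 0" "A $ j $ Some g \<noteq> 0"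
    "\<And>k. k \<noteq> i \<Longrightarrow> k \<noteq> j \<Longrightarrow> A $ k $ Some g = 0" by (auto simp: Q_set_def)
  note M = param_space_imp_model_params[OF P, unfolded model_params_def]
  have S0': "S $ h $ g = 0" if "h \<noteq> g" for h
    using S0[OF that] model_params_sym[OF param_space_imp_model_params[OF P]] by simp
  have t: "t i = g" "t j = g" using M A0 by metis+
  define \<alpha> where "\<alpha> = A $ i $ Some g"
  define \<beta> where "\<beta> = A $ j $ Some g"
  have li: "l $ i > 0" and lj: "l $ j > 0" and \<alpha>: "\<alpha> \<noteq> 0" using M A0 by (auto simp: \<alpha>_def)
  obtain c where c: "c > 0" "c * c > 1" and c\<alpha>: "c * \<alpha> * (c * \<alpha>) = \<alpha> * \<alpha> + l $ i / 2"
    using loading_inflation_factor[OF \<alpha> li] by blast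
  have c\<beta>: "\<beta> * \<beta> / (c * c) + \<beta> * \<beta> * (1 - 1 / (c * c)) = \<beta> * \<beta>"
    using c by (simp add: field_simps)
  define A' :: "real^('g option)^'j::_" where
    "A' = (\<chi> k b. if b = Some g \<and> k = i then c * \<alpha> else if b = Some g \<and> k = j then \<beta> / c else A $ k $ b)"
  define l' :: "real^'j::_" where
    "l' = (\<chi> k. if k = i then l $ i / 2 else if k = j then l $ j + \<beta> * \<beta> * (1 - 1 / (c * c)) else l $ k)"
  have "1 - 1 / (c * c) \<ge> 0" using c by simp
  then have "l $ j + \<beta> * \<beta> * (1 - 1 / (c * c)) > 0" using lj by (intro add_pos_nonneg mult_nonneg_nonneg zero_le_square) auto
  then have M': "model_params t A' S l'"
    using M t by (auto simp: model_params_def A'_def l'_def)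
  have "observed_cov t A' S l' k k' = observed_cov t A S l k k'" for k k'
  proof -
    have A': "A' $ i $ Some g = c * \<alpha>" "A' $ j $ Some g = \<beta> / c" "A' $ k $ None = A $ k $ None" for k
      using ij by (simp_all add: A'_def)
    have A'k: "A' $ k $ b = A $ k $ b" if "k \<noteq> i" "k \<noteq> j" for k b
      using that by (simp add: A'_def)
    have A'n: "A' $ k $ Some b = A $ k $ Some b" if "b \<noteq> g" for k b
      using that by (simp add: A'_def)
    have Sgg: "S $ g $ g = 1" using M by simp
    show ?thesis
      by (cases "k = i"; cases "k = j"; cases "k' = i"; cases "k' = j"; cases "t k = g"; cases "t k' = g")
        (use c ij ij[symmetric] in \<open>simp_all add: observed_cov_def A' A'k A'n A0(3) t l'_def S0 S0' Sgg c\<alpha> c\<beta> flip: \<alpha>_def \<beta>_def\<close>)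
  qed
  from identifiable_up_to_signs(1)[OF P I M' this] have "l' $ i = l $ i" by simp
  then show False using li by (simp add: l'_def)
qed

section \<open>The number of testlets of rank two\<close>

lemma rank_testlet_loadings_ne_2_iff:
  "rank (testlet_loadings t A g) \<noteq> 2 \<longleftrightarrow>
   (\<exists>x y. (x \<noteq> 0 \<or> y \<noteq> 0) \<and> (\<forall>j. t j = g \<longrightarrow> x * A $ j $ None + y * A $ j $ Some g = 0))"
proof -
  let ?M = "testlet_loadings t A g"
  have ker: "?M *v x = 0 \<longleftrightarrow> (\<forall>j. t j = g \<longrightarrow> x $ 1 * A $ j $ None + x $ 2 * A $ j $ Some g = 0)" for x
    by (auto simp: vec_eq_iff testlet_loadings_def matrix_vector_mult_def sum_2 vector_2 mult.commute)
  have "rank ?M = 2 \<longleftrightarrow> inj ((*v) ?M)"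
    using full_rank_injective[of ?M] by simp
  also have "\<dots> \<longleftrightarrow> (\<forall>x. ?M *v x = 0 \<longrightarrow> x = 0)"
    by (rule linear_injective_0) simp
  finally have "rank ?M \<noteq> 2 \<longleftrightarrow> (\<exists>x. x \<noteq> 0 \<and> ?M *v x = 0)" by blast
  also have "\<dots> \<longleftrightarrow> (\<exists>x y. vector [x, y] \<noteq> (0 :: real^2) \<and> ?M *v vector [x, y] = 0)"
  proof -
    have "x = vector [x $ 1, x $ 2]" for x :: "real^2"
      by (simp add: vec_eq_iff forall_2 vector_2)
    then show ?thesis by metis
  qed
  finally show ?thesis
    unfolding ker by (simp add: vector_2 vec_eq_iff forall_2)
qed

text \<open>
  Since some testlet loading is nonzero, linear dependence of the two columns can be solved for the
  main loadings: the items of the testlet see the factors only through \<open>c \<eta>\<^sub>0 + \<eta> g\<close>.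
\<close>

lemma not_H3_obtain_slope:
  assumes "g \<notin> H3_set t A" and "Q_set A g \<noteq> {}" and zero: "\<And>j h. h \<noteq> t j \<Longrightarrow> A $ j $ Some h = 0"
  obtains c where "\<And>j. t j = g \<Longrightarrow> A $ j $ None = c * A $ j $ Some g"
proof -
  obtain x y where xy: "x \<noteq> 0 \<or> y \<noteq> 0"
    and rel: "\<And>j. t j = g \<Longrightarrow> x * A $ j $ None + y * A $ j $ Some g = 0"
    using assms(1) rank_testlet_loadings_ne_2_iff[of t A g] by (auto simp: H3_set_def)
  obtain j where j: "A $ j $ Some g \<noteq> 0" using assms(2) by (auto simp: Q_set_def)
  with zero have "t j = g" by metis
  with rel[of j] j xy have "x \<noteq> 0" by auto
  then have "A $ j $ None = - y / x * A $ j $ Some g" if "t j = g" for j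
    using rel[OF that] by (simp add: field_simps add_eq_0_iff)
  then show ?thesis by (rule that)
qed

text \<open>
  If every testlet sees only \<open>\<xi> g = c g \<eta>\<^sub>0 + \<eta> g\<close>, then the \<open>\<xi> g\<close>, divided by their standard deviations
  \<open>r g\<close>, can serve as testlet factors of a model with zero main loadings.
\<close>

lemma identifiable_imp_main_factor_absorbed:
  fixes t :: "'j::{finite,wellorder} \<Rightarrow> 'g::{finite,wellorder}"
    and A :: "real^('g option)^'j::_" and d :: "real^'j::_"
    and S :: "real^'g::_^'g::_" and l :: "real^'j::_"
  assumes P: "param_space t A d S l" and I: "identifiable_at t A d S l"
    and c: "\<And>j. A $ j $ None = c (t j) * A $ j $ Some (t j)"
  shows "A $ j $ None = 0"
proof -
  note M = param_space_imp_model_params[OF P, unfolded model_params_def]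
  define r where "r g = sqrt (1 + (c g)\<^sup>2)" for g
  have rr: "r g * r g = 1 + c g * c g" for g
    by (simp add: r_def power2_eq_square)
  have r0: "r g \<noteq> 0" for g
    by (metis add_pos_nonneg mult_zero_left order_less_irrefl rr zero_le_square zero_less_one)
  define A' :: "real^('g option)^'j::_" where
    "A' = (\<chi> j b. case b of None \<Rightarrow> 0 | Some g \<Rightarrow> r g * A $ j $ Some g)"
  define S' :: "real^'g::_^'g::_" where
    "S' = (\<chi> g h. (c g * c h + S $ g $ h) / (r g * r h))"
  have "sym_pos_def S'"
    using M r0 by (intro sym_pos_def_rescale_plus_square[of S S' "\<lambda>g. c g / r g" "\<lambda>g. 1 / r g" undefined])
      (auto simp: S'_def add_divide_distrib)
  moreover have "S' $ g $ g = 1" for g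
    using M rr[of g] r0[of g] by (simp add: S'_def add.commute flip: rr)
  ultimately have M': "model_params t A' S' l"
    using M by (auto simp: model_params_def A'_def)
  have "observed_cov t A' S' l i k = observed_cov t A S l i k" for i k
    using r0[of "t i"] r0[of "t k"]
    by (simp add: observed_cov_def A'_def S'_def c[of i] c[of k] field_simps)
  from identifiable_up_to_signs(2)[OF P I M' this, of None]
  show ?thesis by (auto simp: A'_def)
qed

text \<open>
  The exchange of \<open>\<eta>\<^sub>0\<close> and \<open>\<eta> k\<close>.  Outside testlet \<open>k\<close>, \<open>\<xi> g = c g \<eta>\<^sub>0 + \<eta> g\<close> has regression
  coefficient \<open>S k g\<close> on the new main factor \<open>\<eta> k\<close>, and the normalised residual becomes the new testlet
  factor.  In testlet \<open>k\<close> the two loading columns are exchanged, which must not change the main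
  column by more than a sign.
\<close>

lemma identifiable_imp_testlet_loadings_proportional:
  fixes t :: "'j::{finite,wellorder} \<Rightarrow> 'g::{finite,wellorder}"
    and A :: "real^('g option)^'j::_" and d :: "real^'j::_"
    and S :: "real^'g::_^'g::_" and l :: "real^'j::_"
  assumes P: "param_space t A d S l" and I: "identifiable_at t A d S l"
    and c: "\<And>j. t j \<noteq> k \<Longrightarrow> A $ j $ None = c (t j) * A $ j $ Some (t j)"
  obtains s where "s \<in> {1, -1 :: real}" "\<And>j. t j = k \<Longrightarrow> A $ j $ Some k = s * A $ j $ None"
proof -
  note M = param_space_imp_model_params[OF P, unfolded model_params_def]
  have S_sym: "S $ g $ h = S $ h $ g" for g h
    using model_params_sym[OF param_space_imp_model_params[OF P]] by simp
  have S1: "S $ g $ g = 1" for g using M by simp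
  \<comment> \<open>With the value 1 at \<open>k\<close>, the residual \<open>e g \<eta>\<^sub>0 + \<eta> g - S k g \<eta> k\<close> is \<open>\<eta>\<^sub>0\<close> for \<open>g = k\<close>, so the formulas below cover \<open>k\<close> uniformly.\<close>
  define e where "e g = (if g = k then 1 else c g)" for g
  define b :: "'g \<Rightarrow> real^'g::_" where "b g = axis g 1 - S $ k $ g *\<^sub>R axis k 1" for g
  have b_inner: "b g \<bullet> (S *v b h) = S $ g $ h - S $ k $ g * S $ k $ h" for g h
  proof -
    have "S *v axis h 1 = (\<chi> g. S $ g $ h)" for h
      by (simp add: vec_eq_iff matrix_vector_mult_def axis_def if_distrib cong: if_cong)
    then show ?thesis
      using S_sym[of g k]
      by (simp add: b_def matrix_vector_mult_diff_distrib matrix_vector_mult_scaleR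
          inner_diff_left inner_diff_right inner_axis' S1)
  qed
  have pos: "1 + e g * e g - S $ k $ g * S $ k $ g > 0" for g
  proof (cases "g = k")
    case True
    then show ?thesis by (simp add: e_def S1)
  next
    case False
    then have "b g $ g = 1" by (simp add: b_def axis_def)
    then have "b g \<noteq> 0" by auto
    then have "b g \<bullet> (S *v b g) > 0" using M by (auto simp: sym_pos_def_def)
    then have "1 - S $ k $ g * S $ k $ g > 0" by (simp add: b_inner S1)
    moreover have "e g * e g \<ge> 0" by simp
    ultimately show ?thesis by linarith
  qed
  \<comment> \<open>The standard deviation of the residual.\<close>
  define r where "r g = sqrt (1 + e g * e g - S $ k $ g * S $ k $ g)" for g
  have rr: "r g * r g = 1 + e g * e g - S $ k $ g * S $ k $ g" and r0: "r g > 0" for g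
    using pos[of g] by (simp_all add: r_def)
  have rk: "r k = 1" by (simp add: r_def e_def S1)
  define A' :: "real^('g option)^'j::_" where
    "A' = (\<chi> j b. case b of None \<Rightarrow> S $ k $ t j * A $ j $ Some (t j)
       | Some g \<Rightarrow> if g = k \<and> t j = k then A $ j $ None else r g * A $ j $ Some g)"
  define S' :: "real^'g::_^'g::_" where
    "S' = (\<chi> g h. (e g * e h + S $ g $ h - S $ k $ g * S $ k $ h) / (r g * r h))"
  have "sym_pos_def S'"
  proof (rule sym_pos_def_congruence_plus_square[where S = S and v = "\<lambda>g. e g / r g" and b = "\<lambda>g. (1 / r g) *\<^sub>R b g"])
    show "S' $ g $ h = e g / r g * (e h / r h) + (1 / r g) *\<^sub>R b g \<bullet> (S *v ((1 / r h) *\<^sub>R b h))" for g h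
      by (simp add: S'_def matrix_vector_mult_scaleR b_inner add_divide_distrib diff_divide_distrib mult.commute)
    fix x :: "real^'g::_"
    assume 1: "(\<Sum>g\<in>UNIV. x $ g * (e g / r g)) = 0" and 2: "(\<Sum>g\<in>UNIV. x $ g *\<^sub>R (1 / r g) *\<^sub>R b g) = 0"
    have xh: "x $ h = 0" if "h \<noteq> k" for h
    proof -
      have "(\<Sum>g\<in>UNIV. x $ g *\<^sub>R (1 / r g) *\<^sub>R b g) $ h = (\<Sum>g\<in>UNIV. if g = h then x $ h / r h else 0)"
        unfolding sum_component using that by (intro sum.cong) (auto simp: b_def axis_def)
      also have "\<dots> = x $ h / r h" by simp
      finally have "(0 :: real^'g::_) $ h = x $ h / r h" unfolding 2 .
      then show ?thesis using r0[of h] by simp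
    qed
    then have "(\<Sum>g\<in>UNIV. x $ g * (e g / r g)) = (\<Sum>g\<in>UNIV. if g = k then x $ k else 0)"
      by (intro sum.cong) (auto simp: e_def rk)
    with 1 have "x $ k = 0" by simp
    with xh show "x = 0" by (metis vec_eq_iff zero_index)
  qed (use M in simp)
  moreover have "S' $ g $ g = 1" for g
    using pos[of g] by (auto simp: S'_def S1 rr)
  ultimately have M': "model_params t A' S' l"
    using M by (auto simp: model_params_def A'_def)
  have loading: "A' $ j $ None = S $ k $ t j * A $ j $ Some (t j)"
    "t j = k \<Longrightarrow> A' $ j $ Some k = A $ j $ None"
    "t j \<noteq> k \<Longrightarrow> A' $ j $ Some (t j) = r (t j) * A $ j $ Some (t j)" for j
    by (simp_all add: A'_def)
  have "observed_cov t A' S' l i j = observed_cov t A S l i j" for i j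
    using r0[of "t i"] r0[of "t j"] S_sym[of "t i" k]
    by (cases "t i = k"; cases "t j = k")
      (simp_all add: observed_cov_def loading S'_def c e_def rk S1 field_simps)
  from identifiable_up_to_signs(2)[OF P I M' this, of None]
  obtain s where s: "s \<in> {1, -1}" "\<And>j. A' $ j $ None = s * A $ j $ None" by blast
  have "A $ j $ Some k = s * A $ j $ None" if "t j = k" for j
    using s(2)[of j] that by (simp add: loading S1)
  with s(1) show ?thesis by (rule that)
qed

section \<open>The necessary conditions\<close>

theorem theorem3:
  fixes t :: "'j::{finite,wellorder} \<Rightarrow> 'g::{finite,wellorder}"
    and A :: "real^('g option)^'j::_" and d :: "real^'j::_"
    and S :: "real^'g::_^'g::_" and l :: "real^'j::_"
  assumes "surj t"
    and "param_space t A d S l"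
    and "identifiable_at t A d S l"
  shows "((\<forall>g. card (Q_set A g) \<ge> 2) \<and>
          (\<forall>g. (\<forall>h. h \<noteq> g \<longrightarrow> S $ g $ h = 0) \<longrightarrow> card (Q_set A g) \<ge> 3)) \<and>
         card (H3_set t A) \<ge> 2"
proof (intro conjI allI impI)
  note PI = assms(2,3)
  have Q_ne: "Q_set A g \<noteq> {}" for g
    by (rule identifiable_imp_Q_set_nonempty[OF assms])
  have Q_2: "card (Q_set A g) \<ge> 2" for g
  proof (rule ccontr)
    assume "\<not> card (Q_set A g) \<ge> 2"
    moreover have "card (Q_set A g) \<noteq> 0" using Q_ne by simp
    ultimately have "card (Q_set A g) = 1" by linarith
    then show False
      using identifiable_imp_Q_set_not_singleton[OF PI] by (auto simp: card_1_singleton_iff)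
  qed
  then show "card (Q_set A g) \<ge> 2" for g .
  show "card (Q_set A g) \<ge> 3" if "\<forall>h. h \<noteq> g \<longrightarrow> S $ g $ h = 0" for g
  proof (rule ccontr)
    assume "\<not> card (Q_set A g) \<ge> 3"
    with Q_2[of g] have "card (Q_set A g) = 2" by linarith
    then obtain i j where "Q_set A g = {i, j}" "i \<noteq> j" by (auto simp: card_2_iff)
    then show False
      using identifiable_imp_Q_set_not_pair[OF PI, of g i j] that by simp
  qed
  show "card (H3_set t A) \<ge> 2"
  proof (rule ccontr)
    assume "\<not> card (H3_set t A) \<ge> 2"
    then have "card (H3_set t A) = 0 \<or> card (H3_set t A) = 1" by linarith
    then obtain k where k: "H3_set t A \<subseteq> {k}"
      by (auto simp: card_1_singleton_iff)
    have zero: "A $ j $ Some h = 0" if "h \<noteq> t j" for j h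
      using assms(2) that by (simp add: param_space_def)
    have "\<exists>c. \<forall>j. t j = g \<longrightarrow> A $ j $ None = c * A $ j $ Some g" if "g \<notin> H3_set t A" for g
      using not_H3_obtain_slope[OF that Q_ne zero] by blast
    then have "\<forall>g. \<exists>c. g \<notin> H3_set t A \<longrightarrow> (\<forall>j. t j = g \<longrightarrow> A $ j $ None = c * A $ j $ Some g)"
      by blast
    then obtain c where c: "\<And>g j. g \<notin> H3_set t A \<Longrightarrow> t j = g \<Longrightarrow> A $ j $ None = c g * A $ j $ Some g"
      unfolding choice_iff by blast
    have "A $ j $ None = c (t j) * A $ j $ Some (t j)" if "t j \<noteq> k" for j
      using c[of "t j" j] k that by auto
    from identifiable_imp_testlet_loadings_proportional[OF PI this]
    obtain s where s: "s \<in> {1, -1 :: real}" "\<And>j. t j = k \<Longrightarrow> A $ j $ Some k = s * A $ j $ None"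
      by metis
    \<comment> \<open>So \<open>k\<close> has rank at most one too, and the main factor can be absorbed.\<close>
    have "rank (testlet_loadings t A k) \<noteq> 2"
      unfolding rank_testlet_loadings_ne_2_iff
      using s by (intro exI[of _ s] exI[of _ "-1"]) auto
    with k have "H3_set t A = {}" by (auto simp: H3_set_def)
    then have "A $ j $ None = c (t j) * A $ j $ Some (t j)" for j
      using c[of "t j" j] by simp
    then have "A $ j $ None = 0" for j
      by (rule identifiable_imp_main_factor_absorbed[OF PI])
    then have "A $ j $ Some k = 0" for j
      using s zero[of k j] by (cases "t j = k") auto
    then show False using Q_ne[of k] by (auto simp: Q_set_def)
  qed
qed

end
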